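(* Let $\langle \mathsf B,\mathcal F\rangle$ be a display map category with $\mathcal F$-dependent coproducts, and $\mathsf p:\mathsf E\to\mathsf B$ a fibration with fibred products along $\mathcal F$. Then $\mathsf p$ is a dependent Hilbert $\tau$-fibration if and only if for every object $\alpha\in\mathsf E_I$ and every display map $f:I\twoheadrightarrow J$ there uniquely exist an arrow $\tau_{\alpha,f}:J\to I$ and a vertical map $$\overline{\tau}_{\alpha,f}:(\tau_{\alpha,f})^*\alpha\to\prod_f\alpha$$ such that: 1. $f\circ\tau_{\alpha,f}=\mathrm{id}_J$; 2. $\mathrm{id}=\overline{\tau}_{\alpha,f}\circ(\tau_{\alpha,f})^*\varepsilon_\alpha$, where $\varepsilon:f^*\prod_f\Rightarrow\mathrm{id}_{\mathsf E_I}$ is the counit of the adjunction $f^*\dashv\prod_f$; 3. whenever a vertical arrow $u:\prod_g\beta\to\gamma$ (with $g:K\twoheadrightarrow L$ in $\mathcal F$, $\beta\in\mathsf E_K$, $\gamma\in\mathsf E_L$) admits a decomposition $u=h\circ t^*(\varepsilon_\beta)$ for some section $t:L\to K$ of $g$ and some vertical arrow $h:t^*(\beta)\to\gamma$, where $\varepsilon$ is the counit of $g^*\dashv\prod_g$, then $t=\tau_{\beta,g}$ and $h=u\circ\overline{\tau}_{\beta,g}$.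
   Context: Fibrations $\mathsf p:\mathsf E\to\mathsf B$ are cloven Grothendieck fibrations; $\mathsf E_A$ is the fibre over $A$; vertical arrows are those over identities; $u^*$ is reindexing along $u$; canonical isomorphisms such as $g^*u^*\cong(ug)^*$ (in particular $t^*g^*\prod_g\beta\cong\prod_g\beta$ for a section $t$ of $g$) are suppressed. A display map category $\langle\mathsf B,\mathcal F\rangle$ is a category with a class $\mathcal F$ of morphisms (display maps, written $\twoheadrightarrow$) such that pullbacks of $\mathcal F$-maps along arbitrary maps exist and lie in $\mathcal F$. It has $\mathcal F$-dependent coproducts if $\mathcal F$ is closed under composition. $\mathsf p$ has fibred products along $\mathcal F$ if for each $v\in\mathcal F$ the functor $v^*$ has a right adjoint $\prod_v$ and, for every pullback square with $v:L\twoheadrightarrow J$, $f:I\to J$ arbitrary, $u:K\twoheadrightarrow I$, $g:K\to L$, the canonical map $f^*\prod_v\Rightarrow\prod_u g^*$ is an isomorphism (Beck–Chevalley). $\alpha\in\mathsf E_A$ is $(\mathcal F,\prod)$-quantifier splitting if for every $u:B\twoheadrightarrow A$ in $\mathcal F$, every $\beta\in\mathsf E_B$ and every vertical $h:\prod_u\beta\to\alpha$ there exist a unique section $g:A\to B$ of $u$ and a unique vertical $\overline h:g^*\beta\to\alpha$ with $h=\overline h\circ g^*(\varepsilon_\beta)$, where $\varepsilon$ is the counit of $u^*\dashv\prod_u$. It is $(\mathcal F,\prod)$-quantifier-free if $f^*\alpha$ is $(\mathcal F,\prod)$-quantifier splitting for every $f:I\to A$ in $\mathsf B$. $\mathsf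 p$ is a dependent Hilbert $\tau$-fibration if $\langle\mathsf B,\mathcal F\rangle$ has $\mathcal F$-dependent coproducts, $\mathsf p$ has fibred products along $\mathcal F$, and every object of $\mathsf E$ is $(\mathcal F,\prod)$-quantifier-free. *)

theory Defs
  imports "HOL-Library.FuncSet"
begin

subsection \<open>Categories, functors, adjunctions\<close>

text \<open>Composition is written in the usual order: \<open>g \<cdot> f\<close> is \<open>g\<close> after \<open>f\<close>.  All operations are
  total functions whose values are only meaningful on the objects and arrows of the carrier.\<close>

record ('o, 'a) cat =
  Obj :: "'o set"
  Arr :: "'a set"
  Dom :: "'a \<Rightarrow> 'o"
  Cod :: "'a \<Rightarrow> 'o"
  Id :: "'o \<Rightarrow> 'a"
  Comp :: "'a \<Rightarrow> 'a \<Rightarrow> 'a" (infixl "\<cdot>\<index>" 70)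

definition hom :: "('o, 'a) cat \<Rightarrow> 'o \<Rightarrow> 'o \<Rightarrow> 'a set" where
  "hom C a b = {f \<in> Arr C. Dom C f = a \<and> Cod C f = b}"

locale category =
  fixes C :: "('o, 'a) cat" (structure)
  assumes Dom_Obj: "f \<in> Arr C \<Longrightarrow> Dom C f \<in> Obj C"
    and Cod_Obj: "f \<in> Arr C \<Longrightarrow> Cod C f \<in> Obj C"
    and Id_hom: "a \<in> Obj C \<Longrightarrow> Id C a \<in> hom C a a"
    and Comp_hom: "f \<in> hom C a b \<Longrightarrow> g \<in> hom C b c \<Longrightarrow> g \<cdot> f \<in> hom C a c"
    and Comp_Id: "f \<in> hom C a b \<Longrightarrow> f \<cdot> Id C a = f"
    and Id_Comp: "f \<in> hom C a b \<Longrightarrow> Id C b \<cdot> f = f"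
    and Comp_assoc: "f \<in> hom C a b \<Longrightarrow> g \<in> hom C b c \<Longrightarrow> h \<in> hom C c d \<Longrightarrow>
      h \<cdot> (g \<cdot> f) = (h \<cdot> g) \<cdot> f"

definition is_iso :: "('o, 'a) cat \<Rightarrow> 'a \<Rightarrow> bool" where
  "is_iso C f \<longleftrightarrow> f \<in> Arr C \<and>
     (\<exists>g \<in> hom C (Cod C f) (Dom C f).
        g \<cdot>\<^bsub>C\<^esub> f = Id C (Dom C f) \<and> f \<cdot>\<^bsub>C\<^esub> g = Id C (Cod C f))"

definition is_section :: "('o, 'a) cat \<Rightarrow> 'a \<Rightarrow> 'a \<Rightarrow> bool" where
  "is_section C u g \<longleftrightarrow> g \<in> hom C (Cod C u) (Dom C u) \<and> u \<cdot>\<^bsub>C\<^esub> g = Id C (Cod C u)"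

record ('o, 'a, 'o2, 'a2) ftor =
  FObj :: "'o \<Rightarrow> 'o2"
  FArr :: "'a \<Rightarrow> 'a2"

locale is_functor =
  fixes C :: "('o, 'a) cat" and D :: "('o2, 'a2) cat" and F :: "('o, 'a, 'o2, 'a2) ftor"
  assumes source: "category C" and target: "category D"
    and FObj_Obj: "a \<in> Obj C \<Longrightarrow> FObj F a \<in> Obj D"
    and FArr_hom: "f \<in> hom C a b \<Longrightarrow> FArr F f \<in> hom D (FObj F a) (FObj F b)"
    and FArr_Id: "a \<in> Obj C \<Longrightarrow> FArr F (Id C a) = Id D (FObj F a)"
    and FArr_Comp: "f \<in> hom C a b \<Longrightarrow> g \<in> hom C b c \<Longrightarrow>
      FArr F (g \<cdot>\<^bsub>C\<^esub> f) = FArr F g \<cdot>\<^bsub>D\<^esub> FArr F f"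

text \<open>\<open>F : C \<rightarrow> D\<close> is left adjoint to \<open>G : D \<rightarrow> C\<close> with unit \<open>\<eta>\<close> and counit \<open>\<epsilon>\<close>.\<close>

locale adjunction =
  fixes C :: "('o, 'a) cat" and D :: "('o2, 'a2) cat"
    and F :: "('o, 'a, 'o2, 'a2) ftor" and G :: "('o2, 'a2, 'o, 'a) ftor"
    and \<eta> :: "'o \<Rightarrow> 'a" and \<epsilon> :: "'o2 \<Rightarrow> 'a2"
  assumes left: "is_functor C D F" and right: "is_functor D C G"
    and unit_hom: "c \<in> Obj C \<Longrightarrow> \<eta> c \<in> hom C c (FObj G (FObj F c))"
    and unit_natural: "f \<in> hom C c c' \<Longrightarrow>
      \<eta> c' \<cdot>\<^bsub>C\<^esub> f = FArr G (FArr F f) \<cdot>\<^bsub>C\<^esub> \<eta> c"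
    and counit_hom: "d \<in> Obj D \<Longrightarrow> \<epsilon> d \<in> hom D (FObj F (FObj G d)) d"
    and counit_natural: "k \<in> hom D d d' \<Longrightarrow>
      k \<cdot>\<^bsub>D\<^esub> \<epsilon> d = \<epsilon> d' \<cdot>\<^bsub>D\<^esub> FArr F (FArr G k)"
    and triangle_left: "c \<in> Obj C \<Longrightarrow> \<epsilon> (FObj F c) \<cdot>\<^bsub>D\<^esub> FArr F (\<eta> c) = Id D (FObj F c)"
    and triangle_right: "d \<in> Obj D \<Longrightarrow> FArr G (\<epsilon> d) \<cdot>\<^bsub>C\<^esub> \<eta> (FObj G d) = Id C (FObj G d)"


subsection \<open>Display map categories\<close>

text \<open>\<open>is_pullback B v f u g\<close>: the square with \<open>f \<cdot> u = v \<cdot> g\<close> is a pullback, where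
  \<open>v : L \<rightarrow> J\<close>, \<open>f : I \<rightarrow> J\<close>, and \<open>u : K \<rightarrow> I\<close>, \<open>g : K \<rightarrow> L\<close> are the two projections.\<close>

definition is_pullback :: "('o, 'a) cat \<Rightarrow> 'a \<Rightarrow> 'a \<Rightarrow> 'a \<Rightarrow> 'a \<Rightarrow> bool" where
  "is_pullback B v f u g \<longleftrightarrow>
     v \<in> Arr B \<and> f \<in> Arr B \<and> u \<in> Arr B \<and> g \<in> Arr B \<and>
     Cod B v = Cod B f \<and> Cod B u = Dom B f \<and> Cod B g = Dom B v \<and> Dom B u = Dom B g \<and>
     f \<cdot>\<^bsub>B\<^esub> u = v \<cdot>\<^bsub>B\<^esub> g \<and>
     (\<forall>Z\<in>Obj B. \<forall>a \<in> hom B Z (Dom B f). \<forall>b \<in> hom B Z (Dom B v).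
        f \<cdot>\<^bsub>B\<^esub> a = v \<cdot>\<^bsub>B\<^esub> b \<longrightarrow>
        (\<exists>!k. k \<in> hom B Z (Dom B u) \<and> u \<cdot>\<^bsub>B\<^esub> k = a \<and> g \<cdot>\<^bsub>B\<^esub> k = b))"

definition display_map_category :: "('o, 'a) cat \<Rightarrow> 'a set \<Rightarrow> bool" where
  "display_map_category B \<F> \<longleftrightarrow>
     category B \<and> \<F> \<subseteq> Arr B \<and>
     (\<forall>v\<in>\<F>. \<forall>f\<in>Arr B. Cod B f = Cod B v \<longrightarrow>
        (\<exists>u g. is_pullback B v f u g) \<and> (\<forall>u g. is_pullback B v f u g \<longrightarrow> u \<in> \<F>))"

definition has_dependent_coproducts :: "('o, 'a) cat \<Rightarrow> 'a set \<Rightarrow> bool" where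
  "has_dependent_coproducts B \<F> \<longleftrightarrow>
     (\<forall>f\<in>\<F>. \<forall>g\<in>\<F>. Cod B f = Dom B g \<longrightarrow> g \<cdot>\<^bsub>B\<^esub> f \<in> \<F>)"


subsection \<open>Cloven fibrations\<close>

text \<open>\<open>cleave X u \<beta>\<close> is the chosen cartesian arrow over \<open>u\<close> with codomain \<open>\<beta>\<close>.\<close>

record ('bo, 'ba, 'eo, 'ea) fibration =
  Base :: "('bo, 'ba) cat"
  Total :: "('eo, 'ea) cat"
  Proj :: "('eo, 'ea, 'bo, 'ba) ftor"
  cleave :: "'ba \<Rightarrow> 'eo \<Rightarrow> 'ea"

definition is_cartesian :: "('bo, 'ba, 'eo, 'ea) fibration \<Rightarrow> 'ea \<Rightarrow> bool" where
  "is_cartesian X \<phi> \<longleftrightarrow> \<phi> \<in> Arr (Total X) \<and>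
     (\<forall>\<psi>\<in>Arr (Total X). \<forall>w.
        Cod (Total X) \<psi> = Cod (Total X) \<phi> \<and>
        w \<in> hom (Base X) (FObj (Proj X) (Dom (Total X) \<psi>)) (FObj (Proj X) (Dom (Total X) \<phi>)) \<and>
        FArr (Proj X) \<phi> \<cdot>\<^bsub>Base X\<^esub> w = FArr (Proj X) \<psi> \<longrightarrow>
        (\<exists>!\<chi>. \<chi> \<in> hom (Total X) (Dom (Total X) \<psi>) (Dom (Total X) \<phi>) \<and>
             FArr (Proj X) \<chi> = w \<and> \<phi> \<cdot>\<^bsub>Total X\<^esub> \<chi> = \<psi>))"

definition cloven_fibration :: "('bo, 'ba, 'eo, 'ea) fibration \<Rightarrow> bool" where
  "cloven_fibration X \<longleftrightarrow>
     is_functor (Total X) (Base X) (Proj X) \<and>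
     (\<forall>u\<in>Arr (Base X). \<forall>\<beta>\<in>Obj (Total X). FObj (Proj X) \<beta> = Cod (Base X) u \<longrightarrow>
        is_cartesian X (cleave X u \<beta>) \<and>
        Cod (Total X) (cleave X u \<beta>) = \<beta> \<and>
        FArr (Proj X) (cleave X u \<beta>) = u)"

definition fibre :: "('bo, 'ba, 'eo, 'ea) fibration \<Rightarrow> 'bo \<Rightarrow> ('eo, 'ea) cat" where
  "fibre X A = \<lparr>
     Obj = {\<alpha> \<in> Obj (Total X). FObj (Proj X) \<alpha> = A},
     Arr = {\<phi> \<in> Arr (Total X). FObj (Proj X) (Dom (Total X) \<phi>) = A \<and>
              FArr (Proj X) \<phi> = Id (Base X) A},
     Dom = Dom (Total X), Cod = Cod (Total X), Id = Id (Total X), Comp = Comp (Total X)\<rparr>"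

text \<open>The vertical arrow \<open>\<chi>\<close> with \<open>\<phi> \<cdot> \<chi> = \<psi>\<close>.  It is only used when \<open>\<phi>\<close> is a cartesian arrow (or a
  composite of such) and \<open>\<psi>\<close> lies over the same arrow, so that \<open>\<chi>\<close> exists and is unique.\<close>

definition vert :: "('bo, 'ba, 'eo, 'ea) fibration \<Rightarrow> 'ea \<Rightarrow> 'ea \<Rightarrow> 'ea" where
  "vert X \<phi> \<psi> = (THE \<chi>.
     \<chi> \<in> hom (fibre X (FObj (Proj X) (Dom (Total X) \<phi>))) (Dom (Total X) \<psi>) (Dom (Total X) \<phi>) \<and>
     \<phi> \<cdot>\<^bsub>Total X\<^esub> \<chi> = \<psi>)"

definition reindex ::
  "('bo, 'ba, 'eo, 'ea) fibration \<Rightarrow> 'ba \<Rightarrow> ('eo, 'ea, 'eo, 'ea) ftor" where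
  "reindex X u = \<lparr>
     FObj = (\<lambda>\<beta>. Dom (Total X) (cleave X u \<beta>)),
     FArr = (\<lambda>\<phi>. vert X (cleave X u (Cod (Total X) \<phi>))
                       (\<phi> \<cdot>\<^bsub>Total X\<^esub> cleave X u (Dom (Total X) \<phi>)))\<rparr>"

text \<open>The canonical isomorphisms \<open>g\<^sup>* u\<^sup>* \<gamma> \<cong> (u \<cdot> g)\<^sup>* \<gamma>\<close>, in both directions, and
  \<open>\<gamma> \<cong> id\<^sup>* \<gamma>\<close>.\<close>

definition merge :: "('bo, 'ba, 'eo, 'ea) fibration \<Rightarrow> 'ba \<Rightarrow> 'ba \<Rightarrow> 'eo \<Rightarrow> 'ea" where
  "merge X u g \<gamma> = vert X (cleave X (u \<cdot>\<^bsub>Base X\<^esub> g) \<gamma>)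
     (cleave X u \<gamma> \<cdot>\<^bsub>Total X\<^esub> cleave X g (FObj (reindex X u) \<gamma>))"

definition unmerge :: "('bo, 'ba, 'eo, 'ea) fibration \<Rightarrow> 'ba \<Rightarrow> 'ba \<Rightarrow> 'eo \<Rightarrow> 'ea" where
  "unmerge X u g \<gamma> = vert X
     (cleave X u \<gamma> \<cdot>\<^bsub>Total X\<^esub> cleave X g (FObj (reindex X u) \<gamma>))
     (cleave X (u \<cdot>\<^bsub>Base X\<^esub> g) \<gamma>)"

definition to_id_reindex :: "('bo, 'ba, 'eo, 'ea) fibration \<Rightarrow> 'eo \<Rightarrow> 'ea" where
  "to_id_reindex X \<gamma> =
     vert X (cleave X (Id (Base X) (FObj (Proj X) \<gamma>)) \<gamma>) (Id (Total X) \<gamma>)"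

text \<open>For a section \<open>t\<close> of \<open>g\<close>: the canonical isomorphism \<open>\<gamma> \<cong> id\<^sup>* \<gamma> = (g \<cdot> t)\<^sup>* \<gamma> \<cong> t\<^sup>* g\<^sup>* \<gamma>\<close>.\<close>

definition section_iso :: "('bo, 'ba, 'eo, 'ea) fibration \<Rightarrow> 'ba \<Rightarrow> 'ba \<Rightarrow> 'eo \<Rightarrow> 'ea" where
  "section_iso X g t \<gamma> = unmerge X g t \<gamma> \<cdot>\<^bsub>Total X\<^esub> to_id_reindex X \<gamma>"


subsection \<open>Fibred products\<close>

text \<open>A choice, for every \<open>v\<close>, of a functor \<open>\<Prod>\<^sub>v\<close> together with a unit and a counit.\<close>

record ('ba, 'eo, 'ea) products =
  prd :: "'ba \<Rightarrow> ('eo, 'ea, 'eo, 'ea) ftor"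
  prd_unit :: "'ba \<Rightarrow> 'eo \<Rightarrow> 'ea"
  prd_counit :: "'ba \<Rightarrow> 'eo \<Rightarrow> 'ea"

text \<open>The component at \<open>\<beta>\<close> of the canonical map \<open>f\<^sup>* \<Prod>\<^sub>v \<Rightarrow> \<Prod>\<^sub>u g\<^sup>*\<close>: the transpose of
  \<open>u\<^sup>* f\<^sup>* \<Prod>\<^sub>v \<beta> \<cong> (f \<cdot> u)\<^sup>* \<Prod>\<^sub>v \<beta> = (v \<cdot> g)\<^sup>* \<Prod>\<^sub>v \<beta> \<cong> g\<^sup>* v\<^sup>* \<Prod>\<^sub>v \<beta> \<rightarrow> g\<^sup>* \<beta>\<close>.\<close>

definition beck_chevalley_map ::
  "('bo, 'ba, 'eo, 'ea) fibration \<Rightarrow> ('ba, 'eo, 'ea) products \<Rightarrow>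
    'ba \<Rightarrow> 'ba \<Rightarrow> 'ba \<Rightarrow> 'ba \<Rightarrow> 'eo \<Rightarrow> 'ea" where
  "beck_chevalley_map X P v f u g \<beta> =
     (let \<pi> = FObj (prd P v) \<beta>;
          k = FArr (reindex X g) (prd_counit P v \<beta>) \<cdot>\<^bsub>Total X\<^esub>
              (unmerge X v g \<pi> \<cdot>\<^bsub>Total X\<^esub> merge X f u \<pi>)
      in FArr (prd P u) k \<cdot>\<^bsub>Total X\<^esub> prd_unit P u (FObj (reindex X f) \<pi>))"

definition fibred_products ::
  "('bo, 'ba, 'eo, 'ea) fibration \<Rightarrow> 'ba set \<Rightarrow> ('ba, 'eo, 'ea) products \<Rightarrow> bool" where
  "fibred_products X \<F> P \<longleftrightarrow>
     (\<forall>v\<in>\<F>. adjunction (fibre X (Cod (Base X) v)) (fibre X (Dom (Base X) v))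
               (reindex X v) (prd P v) (prd_unit P v) (prd_counit P v)) \<and>
     (\<forall>v\<in>\<F>. \<forall>u\<in>\<F>. \<forall>f g. is_pullback (Base X) v f u g \<longrightarrow>
        (\<forall>\<beta> \<in> Obj (fibre X (Dom (Base X) v)).
           is_iso (fibre X (Dom (Base X) f)) (beck_chevalley_map X P v f u g \<beta>)))"

text \<open>For a section \<open>t\<close> of \<open>g\<close>: the arrow \<open>t\<^sup>*(\<epsilon>\<^sub>\<beta>) : \<Prod>\<^sub>g \<beta> \<rightarrow> t\<^sup>* \<beta>\<close>, where its domain
  \<open>t\<^sup>* g\<^sup>* \<Prod>\<^sub>g \<beta>\<close> has been replaced by \<open>\<Prod>\<^sub>g \<beta>\<close> along the canonical isomorphism.\<close>

definition counit_at ::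
  "('bo, 'ba, 'eo, 'ea) fibration \<Rightarrow> ('ba, 'eo, 'ea) products \<Rightarrow> 'ba \<Rightarrow> 'ba \<Rightarrow> 'eo \<Rightarrow> 'ea" where
  "counit_at X P g t \<beta> =
     FArr (reindex X t) (prd_counit P g \<beta>) \<cdot>\<^bsub>Total X\<^esub> section_iso X g t (FObj (prd P g) \<beta>)"


subsection \<open>Dependent Hilbert \<open>\<tau>\<close>-fibrations\<close>

text \<open>Unique existence is that of the pair \<open>(g, h')\<close>.\<close>

definition quantifier_splitting ::
  "('bo, 'ba, 'eo, 'ea) fibration \<Rightarrow> 'ba set \<Rightarrow> ('ba, 'eo, 'ea) products \<Rightarrow> 'eo \<Rightarrow> bool" where
  "quantifier_splitting X \<F> P \<alpha> \<longleftrightarrow>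
     (\<forall>u\<in>\<F>. Cod (Base X) u = FObj (Proj X) \<alpha> \<longrightarrow>
       (\<forall>\<beta> \<in> Obj (fibre X (Dom (Base X) u)).
        \<forall>h \<in> hom (fibre X (Cod (Base X) u)) (FObj (prd P u) \<beta>) \<alpha>.
          \<exists>!(g, h'). is_section (Base X) u g \<and>
             h' \<in> hom (fibre X (Cod (Base X) u)) (FObj (reindex X g) \<beta>) \<alpha> \<and>
             h = h' \<cdot>\<^bsub>Total X\<^esub> counit_at X P u g \<beta>))"

definition quantifier_free ::
  "('bo, 'ba, 'eo, 'ea) fibration \<Rightarrow> 'ba set \<Rightarrow> ('ba, 'eo, 'ea) products \<Rightarrow> 'eo \<Rightarrow> bool" where
  "quantifier_free X \<F> P \<alpha> \<longleftrightarrow>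
     (\<forall>f\<in>Arr (Base X). Cod (Base X) f = FObj (Proj X) \<alpha> \<longrightarrow>
        quantifier_splitting X \<F> P (FObj (reindex X f) \<alpha>))"

definition dependent_hilbert_tau_fibration ::
  "('bo, 'ba, 'eo, 'ea) fibration \<Rightarrow> 'ba set \<Rightarrow> ('ba, 'eo, 'ea) products \<Rightarrow> bool" where
  "dependent_hilbert_tau_fibration X \<F> P \<longleftrightarrow>
     display_map_category (Base X) \<F> \<and> has_dependent_coproducts (Base X) \<F> \<and>
     cloven_fibration X \<and> fibred_products X \<F> P \<and>
     (\<forall>\<alpha>\<in>Obj (Total X). quantifier_free X \<F> P \<alpha>)"

text \<open>The pairs \<open>(\<alpha>, f)\<close> of a display map \<open>f : I \<rightarrow> J\<close> and an object \<open>\<alpha>\<close> of the fibre over \<open>I\<close>.\<close>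

definition display_objects ::
  "('bo, 'ba, 'eo, 'ea) fibration \<Rightarrow> 'ba set \<Rightarrow> ('eo \<times> 'ba) set" where
  "display_objects X \<F> = {(\<alpha>, f). f \<in> \<F> \<and> \<alpha> \<in> Obj (fibre X (Dom (Base X) f))}"

end

theory Submission
  imports Defs
begin

text \<open>A decomposition \<open>id = \<tau>' \<cdot> \<tau>\<^sup>*\<epsilon>\<close> of the identity of \<open>\<Prod>\<^sub>f \<alpha>\<close> yields the decomposition
  \<open>u = (u \<cdot> \<tau>') \<cdot> \<tau>\<^sup>*\<epsilon>\<close> of any vertical \<open>u : \<Prod>\<^sub>f \<alpha> \<rightarrow> \<gamma>\<close>, and condition 3 says that \<open>u\<close> has no
  other one.  So, given condition 2, condition 3 amounts to every object being quantifier
  splitting.  Quantifier-freeness of all objects is the same, since \<open>\<alpha> \<cong> id\<^sup>* \<alpha>\<close> and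
  quantifier splitting is invariant under vertical isomorphism.\<close>

section \<open>Fibres and vertical arrows\<close>

lemma fibre_simps [simp]:
  "Obj (fibre X A) = {\<alpha> \<in> Obj (Total X). FObj (Proj X) \<alpha> = A}"
  "Id (fibre X A) = Id (Total X)" "Comp (fibre X A) = Comp (Total X)"
  "Dom (fibre X A) = Dom (Total X)" "Cod (fibre X A) = Cod (Total X)"
  by (simp_all add: fibre_def)

lemma hom_fibre_iff:
  "\<phi> \<in> hom (fibre X A) a b \<longleftrightarrow>
     \<phi> \<in> hom (Total X) a b \<and> FObj (Proj X) a = A \<and> FArr (Proj X) \<phi> = Id (Base X) A"
  by (auto simp: hom_def fibre_def)

text \<open>The common shape of all decompositions involved. Quantifier splitting asks for a unique
  pair \<open>(t, k)\<close> for each \<open>h\<close>; conditions 1 and 2 are the case where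
  \<open>\<gamma>\<close> is the product object and \<open>h\<close> its identity; the premise of
  condition 3 is the general case.\<close>

definition splits ::
  "('bo, 'ba, 'eo, 'ea) fibration \<Rightarrow> ('ba, 'eo, 'ea) products \<Rightarrow>
    'ba \<Rightarrow> 'eo \<Rightarrow> 'eo \<Rightarrow> 'ea \<Rightarrow> 'ba \<Rightarrow> 'ea \<Rightarrow> bool" where
  "splits X P u \<beta> \<gamma> h t k \<longleftrightarrow> is_section (Base X) u t \<and>
     k \<in> hom (fibre X (Cod (Base X) u)) (FObj (reindex X t) \<beta>) \<gamma> \<and>
     h = k \<cdot>\<^bsub>Total X\<^esub> counit_at X P u t \<beta>"

context
  fixes X :: "('bo, 'ba, 'eo, 'ea) fibration"
  assumes cloven: "cloven_fibration X"
begin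

interpretation p: is_functor "Total X" "Base X" "Proj X"
  using cloven by (simp add: cloven_fibration_def)
interpretation T: category "Total X" by (rule p.source)
interpretation B: category "Base X" by (rule p.target)

text \<open>The arrows of \<open>fibre X A\<close> are constrained only by their domain and by lying
  over \<open>Id (Base X) A\<close>. Functoriality of the projection then places the codomain over
  \<open>A\<close> as well.\<close>

lemma hom_fibre_Cod:
  assumes "\<phi> \<in> hom (fibre X A) a b"
  shows "FObj (Proj X) b = A"
proof -
  have \<phi>: "\<phi> \<in> hom (Total X) a b" and A: "FObj (Proj X) a = A"
    and Id: "FArr (Proj X) \<phi> = Id (Base X) A"
    using assms by (auto simp: hom_fibre_iff)
  have "a \<in> Obj (Total X)" using \<phi> T.Dom_Obj by (auto simp: hom_def)
  then have "A \<in> Obj (Base X)" using A p.FObj_Obj by blast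
  then show ?thesis using p.FArr_hom[OF \<phi>] B.Id_hom[of A] Id by (simp add: hom_def)
qed

lemma hom_fibre_Obj:
  assumes "\<phi> \<in> hom (fibre X A) a b"
  shows "a \<in> Obj (fibre X A)" "b \<in> Obj (fibre X A)"
  using assms[unfolded hom_fibre_iff] hom_fibre_Cod[OF assms] T.Dom_Obj T.Cod_Obj
  by (auto simp: hom_def)

lemma category_fibre: "category (fibre X A)"
proof
  fix f assume "f \<in> Arr (fibre X A)"
  then have "f \<in> hom (fibre X A) (Dom (fibre X A) f) (Cod (fibre X A) f)" by (simp add: hom_def)
  then show "Dom (fibre X A) f \<in> Obj (fibre X A)" "Cod (fibre X A) f \<in> Obj (fibre X A)"
    by (rule hom_fibre_Obj)+
next
  fix a assume "a \<in> Obj (fibre X A)"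
  then show "Id (fibre X A) a \<in> hom (fibre X A) a a"
    using T.Id_hom p.FArr_Id by (auto simp: hom_fibre_iff)
next
  fix f g a b c assume f: "f \<in> hom (fibre X A) a b" and g: "g \<in> hom (fibre X A) b c"
  have "A \<in> Obj (Base X)" using hom_fibre_Obj(1)[OF f] p.FObj_Obj by auto
  then show "g \<cdot>\<^bsub>fibre X A\<^esub> f \<in> hom (fibre X A) a c"
    using f g T.Comp_hom p.FArr_Comp B.Comp_Id[OF B.Id_hom]
    by (fastforce simp: hom_fibre_iff)
next
  fix f a b assume "f \<in> hom (fibre X A) a b"
  then show "f \<cdot>\<^bsub>fibre X A\<^esub> Id (fibre X A) a = f" "Id (fibre X A) b \<cdot>\<^bsub>fibre X A\<^esub> f = f"
    using T.Comp_Id T.Id_Comp by (auto simp: hom_fibre_iff)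
next
  fix f g h a b c d
  assume "f \<in> hom (fibre X A) a b" "g \<in> hom (fibre X A) b c" "h \<in> hom (fibre X A) c d"
  then show "h \<cdot>\<^bsub>fibre X A\<^esub> (g \<cdot>\<^bsub>fibre X A\<^esub> f) = (h \<cdot>\<^bsub>fibre X A\<^esub> g) \<cdot>\<^bsub>fibre X A\<^esub> f"
    using T.Comp_assoc by (auto simp: hom_fibre_iff)
qed

lemma fibre_Id_hom: "a \<in> Obj (fibre X A) \<Longrightarrow> Id (Total X) a \<in> hom (fibre X A) a a"
  using category.Id_hom[OF category_fibre] by (metis fibre_simps(2))

text \<open>Composites of vertical arrows are written with the composition of \<open>Total X\<close>
  throughout, so the category laws of a fibre are restated in that form.\<close>

lemmas fibre_Comp_hom = category.Comp_hom[OF category_fibre, simplified fibre_simps]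
lemmas fibre_Comp_Id = category.Comp_Id[OF category_fibre, simplified fibre_simps]
lemmas fibre_Id_Comp = category.Id_Comp[OF category_fibre, simplified fibre_simps]
lemmas fibre_Comp_assoc = category.Comp_assoc[OF category_fibre, simplified fibre_simps]

section \<open>Cartesian arrows, reindexing and the canonical isomorphisms\<close>

text \<open>The universal property of a cartesian arrow, taken at an identity of the base. It is
  what makes the definite description in \<open>vert\<close> meaningful.\<close>

lemma cartesian_unique_vertical:
  assumes \<phi>: "is_cartesian X \<phi>" and \<psi>: "\<psi> \<in> Arr (Total X)"
    and Cod: "Cod (Total X) \<psi> = Cod (Total X) \<phi>"
    and over: "FArr (Proj X) \<psi> = FArr (Proj X) \<phi>"
  shows "\<exists>!\<chi>. \<chi> \<in> hom (fibre X (FObj (Proj X) (Dom (Total X) \<phi>))) (Dom (Total X) \<psi>) (Dom (Total X) \<phi>)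
    \<and> \<phi> \<cdot>\<^bsub>Total X\<^esub> \<chi> = \<psi>"
proof -
  let ?A = "FObj (Proj X) (Dom (Total X) \<phi>)"
  have \<phi>': "\<phi> \<in> hom (Total X) (Dom (Total X) \<phi>) (Cod (Total X) \<phi>)"
    using \<phi> by (simp add: is_cartesian_def hom_def)
  have \<psi>': "\<psi> \<in> hom (Total X) (Dom (Total X) \<psi>) (Cod (Total X) \<phi>)"
    using \<psi> Cod by (simp add: hom_def)
  have A: "FObj (Proj X) (Dom (Total X) \<psi>) = ?A"
    using p.FArr_hom[OF \<phi>'] p.FArr_hom[OF \<psi>'] over by (simp add: hom_def)
  have "?A \<in> Obj (Base X)" using T.Dom_Obj[of \<phi>] \<phi>' p.FObj_Obj by (auto simp: hom_def)
  then have "Id (Base X) ?A \<in> hom (Base X) ?A ?A" by (rule B.Id_hom)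
  moreover have "FArr (Proj X) \<phi> \<cdot>\<^bsub>Base X\<^esub> Id (Base X) ?A = FArr (Proj X) \<psi>"
    using B.Comp_Id[OF p.FArr_hom[OF \<phi>']] over by simp
  ultimately have "\<exists>!\<chi>. \<chi> \<in> hom (Total X) (Dom (Total X) \<psi>) (Dom (Total X) \<phi>) \<and>
      FArr (Proj X) \<chi> = Id (Base X) ?A \<and> \<phi> \<cdot>\<^bsub>Total X\<^esub> \<chi> = \<psi>"
    using \<phi> \<psi> Cod A unfolding is_cartesian_def by metis
  then show ?thesis by (simp add: hom_fibre_iff A conj_assoc)
qed

lemma vert:
  assumes "is_cartesian X \<phi>" "\<psi> \<in> Arr (Total X)"
    "Cod (Total X) \<psi> = Cod (Total X) \<phi>" "FArr (Proj X) \<psi> = FArr (Proj X) \<phi>"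
  shows vert_hom: "vert X \<phi> \<psi> \<in>
      hom (fibre X (FObj (Proj X) (Dom (Total X) \<phi>))) (Dom (Total X) \<psi>) (Dom (Total X) \<phi>)"
    and Comp_vert: "\<phi> \<cdot>\<^bsub>Total X\<^esub> vert X \<phi> \<psi> = \<psi>"
  using theI'[OF cartesian_unique_vertical[OF assms]] unfolding vert_def by blast+

text \<open>An arrow \<open>\<rho>\<close> is factored in two stages, first through
  \<open>\<phi>\<close> and then through \<open>\<psi>\<close>. The result is needed because
  \<open>unmerge\<close> applies \<open>vert\<close> to a composite of two cleavage arrows.\<close>

lemma cartesian_Comp:
  assumes \<phi>: "is_cartesian X \<phi>" and \<psi>: "is_cartesian X \<psi>"
    and eq: "Cod (Total X) \<psi> = Dom (Total X) \<phi>"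
  shows "is_cartesian X (\<phi> \<cdot>\<^bsub>Total X\<^esub> \<psi>)"
proof -
  let ?b = "Dom (Total X) \<phi>" let ?a = "Dom (Total X) \<psi>" let ?c = "Cod (Total X) \<phi>"
  have \<phi>h: "\<phi> \<in> hom (Total X) ?b ?c" using \<phi> by (simp add: is_cartesian_def hom_def)
  have \<psi>h: "\<psi> \<in> hom (Total X) ?a ?b" using \<psi> eq by (simp add: is_cartesian_def hom_def)
  have c: "\<phi> \<cdot>\<^bsub>Total X\<^esub> \<psi> \<in> hom (Total X) ?a ?c" by (rule T.Comp_hom[OF \<psi>h \<phi>h])
  have "\<exists>!\<chi>. \<chi> \<in> hom (Total X) (Dom (Total X) \<rho>) ?a \<and> FArr (Proj X) \<chi> = w \<and>
             (\<phi> \<cdot>\<^bsub>Total X\<^esub> \<psi>) \<cdot>\<^bsub>Total X\<^esub> \<chi> = \<rho>"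
    if \<rho>: "\<rho> \<in> Arr (Total X)" "Cod (Total X) \<rho> = ?c"
      and w: "w \<in> hom (Base X) (FObj (Proj X) (Dom (Total X) \<rho>)) (FObj (Proj X) ?a)"
      and pw: "FArr (Proj X) (\<phi> \<cdot>\<^bsub>Total X\<^esub> \<psi>) \<cdot>\<^bsub>Base X\<^esub> w = FArr (Proj X) \<rho>" for \<rho> w
  proof -
    let ?d = "Dom (Total X) \<rho>" let ?v = "FArr (Proj X) \<psi> \<cdot>\<^bsub>Base X\<^esub> w"
    have v: "?v \<in> hom (Base X) (FObj (Proj X) ?d) (FObj (Proj X) ?b)"
      by (rule B.Comp_hom[OF w p.FArr_hom[OF \<psi>h]])
    have pv: "FArr (Proj X) \<phi> \<cdot>\<^bsub>Base X\<^esub> ?v = FArr (Proj X) \<rho>"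
      using B.Comp_assoc[OF w p.FArr_hom[OF \<psi>h] p.FArr_hom[OF \<phi>h]] pw p.FArr_Comp[OF \<psi>h \<phi>h]
      by simp
    \<comment> \<open>First stage: \<open>\<sigma>\<close> factors \<open>\<rho>\<close> through
      \<open>\<phi>\<close> over the composite of \<open>w\<close> with the projection of
      \<open>\<psi>\<close>.\<close>
    have "\<exists>!\<sigma>. \<sigma> \<in> hom (Total X) ?d ?b \<and> FArr (Proj X) \<sigma> = ?v \<and> \<phi> \<cdot>\<^bsub>Total X\<^esub> \<sigma> = \<rho>"
      using \<phi> \<rho> v pv unfolding is_cartesian_def by blast
    then obtain \<sigma> where \<sigma>: "\<sigma> \<in> hom (Total X) ?d ?b" "FArr (Proj X) \<sigma> = ?v"
        "\<phi> \<cdot>\<^bsub>Total X\<^esub> \<sigma> = \<rho>"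
      and \<sigma>_unique: "\<And>\<sigma>'. \<sigma>' \<in> hom (Total X) ?d ?b \<Longrightarrow> FArr (Proj X) \<sigma>' = ?v \<Longrightarrow>
        \<phi> \<cdot>\<^bsub>Total X\<^esub> \<sigma>' = \<rho> \<Longrightarrow> \<sigma>' = \<sigma>"
      by blast
    have dom: "Dom (Total X) \<sigma> = ?d" using \<sigma>(1) by (simp add: hom_def)
    have "\<exists>!\<chi>. \<chi> \<in> hom (Total X) (Dom (Total X) \<sigma>) ?a \<and> FArr (Proj X) \<chi> = w \<and>
        \<psi> \<cdot>\<^bsub>Total X\<^esub> \<chi> = \<sigma>"
    proof -
      have "\<sigma> \<in> Arr (Total X)" "Cod (Total X) \<sigma> = Cod (Total X) \<psi>"
        using \<sigma>(1) eq by (auto simp: hom_def)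
      then show ?thesis using \<psi> \<sigma>(2) w unfolding is_cartesian_def dom[symmetric] by metis
    qed
    then have "\<exists>!\<chi>. \<chi> \<in> hom (Total X) ?d ?a \<and> FArr (Proj X) \<chi> = w \<and> \<psi> \<cdot>\<^bsub>Total X\<^esub> \<chi> = \<sigma>"
      by (simp only: dom)
    \<comment> \<open>Uniqueness of \<open>\<sigma>\<close> gives the direction from right to left,
      so the two factorization problems have the same solutions over \<open>w\<close>.\<close>
    moreover have "\<psi> \<cdot>\<^bsub>Total X\<^esub> \<chi> = \<sigma> \<longleftrightarrow> (\<phi> \<cdot>\<^bsub>Total X\<^esub> \<psi>) \<cdot>\<^bsub>Total X\<^esub> \<chi> = \<rho>"
      if \<chi>: "\<chi> \<in> hom (Total X) ?d ?a" and "FArr (Proj X) \<chi> = w" for \<chi>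
      using \<sigma>(3) \<sigma>_unique[OF T.Comp_hom[OF \<chi> \<psi>h]] p.FArr_Comp[OF \<chi> \<psi>h]
        T.Comp_assoc[OF \<chi> \<psi>h \<phi>h] that by auto
    ultimately show ?thesis by metis
  qed
  then show ?thesis
    using c by (auto simp: is_cartesian_def hom_def)
qed

lemma cleave:
  assumes "u \<in> hom (Base X) A A'" "\<beta> \<in> Obj (fibre X A')"
  shows cleave_cartesian: "is_cartesian X (cleave X u \<beta>)"
    and cleave_hom: "cleave X u \<beta> \<in> hom (Total X) (FObj (reindex X u) \<beta>) \<beta>"
    and FArr_cleave: "FArr (Proj X) (cleave X u \<beta>) = u"
    and reindex_Obj: "FObj (reindex X u) \<beta> \<in> Obj (fibre X A)"
proof -
  show c: "is_cartesian X (cleave X u \<beta>)" and u: "FArr (Proj X) (cleave X u \<beta>) = u"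
    using cloven assms by (auto simp: cloven_fibration_def hom_def)
  show h: "cleave X u \<beta> \<in> hom (Total X) (FObj (reindex X u) \<beta>) \<beta>"
    using cloven assms c by (auto simp: cloven_fibration_def hom_def is_cartesian_def reindex_def)
  show "FObj (reindex X u) \<beta> \<in> Obj (fibre X A)"
    using p.FArr_hom[OF h] u assms(1) h T.Dom_Obj[of "cleave X u \<beta>"] by (auto simp: hom_def)
qed

text \<open>Since \<open>\<phi>\<close> is vertical, composing it with a cleavage arrow over
  \<open>u\<close> stays over \<open>u\<close>, so \<open>vert\<close> yields a vertical
  arrow.\<close>

lemma reindex_Arr_hom:
  assumes u: "u \<in> hom (Base X) A A'" and \<phi>: "\<phi> \<in> hom (fibre X A') a b"
  shows "FArr (reindex X u) \<phi> \<in>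
    hom (fibre X A) (FObj (reindex X u) a) (FObj (reindex X u) b)"
proof -
  note a = cleave[OF u hom_fibre_Obj(1)[OF \<phi>]] and b = cleave[OF u hom_fibre_Obj(2)[OF \<phi>]]
  have \<phi>': "\<phi> \<in> hom (Total X) a b" "FArr (Proj X) \<phi> = Id (Base X) A'"
    using \<phi> by (auto simp: hom_fibre_iff)
  have c: "\<phi> \<cdot>\<^bsub>Total X\<^esub> cleave X u a \<in> hom (Total X) (FObj (reindex X u) a) b"
    by (rule T.Comp_hom[OF a(2) \<phi>'(1)])
  have over: "FArr (Proj X) (\<phi> \<cdot>\<^bsub>Total X\<^esub> cleave X u a) = u"
    using p.FArr_Comp[OF a(2) \<phi>'(1)] \<phi>'(2) a(3) B.Id_Comp[OF u] by simp
  have "FArr (reindex X u) \<phi> = vert X (cleave X u b) (\<phi> \<cdot>\<^bsub>Total X\<^esub> cleave X u a)"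
    using \<phi>' by (simp add: reindex_def hom_def)
  then show ?thesis
    using vert_hom[OF b(1), of "\<phi> \<cdot>\<^bsub>Total X\<^esub> cleave X u a"] c over b by (simp add: hom_def)
qed

lemma unmerge_hom:
  assumes g: "g \<in> hom (Base X) A A'" and u: "u \<in> hom (Base X) A' A''"
    and \<gamma>: "\<gamma> \<in> Obj (fibre X A'')"
  shows "unmerge X u g \<gamma> \<in> hom (fibre X A) (FObj (reindex X (u \<cdot>\<^bsub>Base X\<^esub> g)) \<gamma>)
     (FObj (reindex X g) (FObj (reindex X u) \<gamma>))"
proof -
  note cu = cleave[OF u \<gamma>]
  note cg = cleave[OF g cu(4)]
  note cug = cleave[OF B.Comp_hom[OF g u] \<gamma>]
  let ?\<phi> = "cleave X u \<gamma> \<cdot>\<^bsub>Total X\<^esub> cleave X g (FObj (reindex X u) \<gamma>)"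
  have "is_cartesian X ?\<phi>" using cartesian_Comp[OF cu(1) cg(1)] cu(2) cg(2) by (simp add: hom_def)
  moreover have "?\<phi> \<in> hom (Total X) (FObj (reindex X g) (FObj (reindex X u) \<gamma>)) \<gamma>"
    by (rule T.Comp_hom[OF cg(2) cu(2)])
  moreover have "FArr (Proj X) ?\<phi> = u \<cdot>\<^bsub>Base X\<^esub> g"
    using p.FArr_Comp[OF cg(2) cu(2)] cu(3) cg(3) by simp
  ultimately show ?thesis
    using vert_hom[of ?\<phi> "cleave X (u \<cdot>\<^bsub>Base X\<^esub> g) \<gamma>"] cug cg(4)
    by (simp add: unmerge_def hom_def)
qed

lemma to_id_reindex:
  assumes \<gamma>: "\<gamma> \<in> Obj (fibre X A)"
  shows to_id_reindex_hom:
      "to_id_reindex X \<gamma> \<in> hom (fibre X A) \<gamma> (FObj (reindex X (Id (Base X) A)) \<gamma>)"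
    and cleave_to_id_reindex:
      "cleave X (Id (Base X) A) \<gamma> \<cdot>\<^bsub>Total X\<^esub> to_id_reindex X \<gamma> = Id (Total X) \<gamma>"
proof -
  have A: "FObj (Proj X) \<gamma> = A" and \<gamma>T: "\<gamma> \<in> Obj (Total X)" using \<gamma> by auto
  then have "Id (Base X) A \<in> hom (Base X) A A" using B.Id_hom p.FObj_Obj by blast
  note c = cleave[OF this \<gamma>]
  note I = T.Id_hom[OF \<gamma>T] p.FArr_Id[OF \<gamma>T]
  have d: "to_id_reindex X \<gamma> = vert X (cleave X (Id (Base X) A) \<gamma>) (Id (Total X) \<gamma>)"
    by (simp add: to_id_reindex_def A)
  show "to_id_reindex X \<gamma> \<in> hom (fibre X A) \<gamma> (FObj (reindex X (Id (Base X) A)) \<gamma>)"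
    using vert_hom[OF c(1), of "Id (Total X) \<gamma>"] c I A d by (simp add: hom_def)
  show "cleave X (Id (Base X) A) \<gamma> \<cdot>\<^bsub>Total X\<^esub> to_id_reindex X \<gamma> = Id (Total X) \<gamma>"
    using Comp_vert[OF c(1), of "Id (Total X) \<gamma>"] c I A d by (simp add: hom_def)
qed

text \<open>A cartesian arrow over an identity is invertible. The inverse is
  \<open>to_id_reindex\<close>: one composite is the identity by construction, the other by
  uniqueness of vertical factorizations.\<close>

lemma is_iso_cleave_Id:
  assumes \<gamma>: "\<gamma> \<in> Obj (fibre X A)"
  shows "cleave X (Id (Base X) A) \<gamma> \<in> hom (fibre X A) (FObj (reindex X (Id (Base X) A)) \<gamma>) \<gamma>"
    and "is_iso (fibre X A) (cleave X (Id (Base X) A) \<gamma>)"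
proof -
  let ?c = "cleave X (Id (Base X) A) \<gamma>" and ?r = "FObj (reindex X (Id (Base X) A)) \<gamma>"
  have "Id (Base X) A \<in> hom (Base X) A A" using \<gamma> B.Id_hom p.FObj_Obj by auto
  note c = cleave[OF this \<gamma>]
  show ch: "?c \<in> hom (fibre X A) ?r \<gamma>" using c by (auto simp: hom_fibre_iff)
  note i = to_id_reindex[OF \<gamma>]
  have "FObj (Proj X) (Dom (Total X) ?c) = A" "Dom (Total X) ?c = ?r"
    using c by (auto simp: hom_def)
  \<comment> \<open>Both the identity and \<open>to_id_reindex\<close> after \<open>?c\<close> are
    such a \<open>\<chi>\<close>, hence they agree.\<close>
  then have "\<exists>!\<chi>. \<chi> \<in> hom (fibre X A) ?r ?r \<and> ?c \<cdot>\<^bsub>Total X\<^esub> \<chi> = ?c"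
    using cartesian_unique_vertical[OF c(1), of ?c] c(2) by (simp add: hom_def)
  moreover have "?c \<cdot>\<^bsub>Total X\<^esub> (to_id_reindex X \<gamma> \<cdot>\<^bsub>Total X\<^esub> ?c) = ?c"
    using fibre_Comp_assoc[OF ch i(1) ch] i(2) fibre_Id_Comp[OF ch] by simp
  moreover have "?c \<cdot>\<^bsub>Total X\<^esub> Id (Total X) ?r = ?c" by (rule fibre_Comp_Id[OF ch])
  ultimately have "to_id_reindex X \<gamma> \<cdot>\<^bsub>Total X\<^esub> ?c = Id (Total X) ?r"
    using fibre_Comp_hom[OF ch i(1)] fibre_Id_hom[OF c(4)] by auto
  then show "is_iso (fibre X A) ?c"
    using ch i by (auto simp: is_iso_def hom_def)
qed

text \<open>For a section, \<open>u \<cdot> t\<close> equals the identity of \<open>L\<close>, so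
  the codomain of \<open>to_id_reindex\<close> is literally the domain of \<open>unmerge\<close> and
  the two compose.\<close>

lemma section_iso_hom:
  assumes u: "u \<in> hom (Base X) K L" and t: "is_section (Base X) u t"
    and \<gamma>: "\<gamma> \<in> Obj (fibre X L)"
  shows "section_iso X u t \<gamma> \<in>
    hom (fibre X L) \<gamma> (FObj (reindex X t) (FObj (reindex X u) \<gamma>))"
proof -
  have t': "t \<in> hom (Base X) L K" "u \<cdot>\<^bsub>Base X\<^esub> t = Id (Base X) L"
    using t u by (auto simp: is_section_def hom_def)
  show ?thesis
    using fibre_Comp_hom[OF to_id_reindex_hom[OF \<gamma>]] unmerge_hom[OF t'(1) u \<gamma>]
    by (simp add: section_iso_def t'(2))
qed

section \<open>Splittings of arrows out of a product\<close>

context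
  fixes \<F> :: "'ba set" and P :: "('ba, 'eo, 'ea) products"
  assumes display: "\<F> \<subseteq> Arr (Base X)" and products: "fibred_products X \<F> P"
begin

lemma products_adjunction:
  assumes "u \<in> \<F>"
  shows "adjunction (fibre X (Cod (Base X) u)) (fibre X (Dom (Base X) u))
    (reindex X u) (prd P u) (prd_unit P u) (prd_counit P u)"
  using products assms by (simp add: fibred_products_def)

lemma prd_Obj:
  assumes "u \<in> \<F>" "\<beta> \<in> Obj (fibre X (Dom (Base X) u))"
  shows "FObj (prd P u) \<beta> \<in> Obj (fibre X (Cod (Base X) u))"
  using is_functor.FObj_Obj[OF adjunction.right[OF products_adjunction]] assms by blast

lemma counit_at_hom:
  assumes u: "u \<in> \<F>" and \<beta>: "\<beta> \<in> Obj (fibre X (Dom (Base X) u))"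
    and t: "is_section (Base X) u t"
  shows "counit_at X P u t \<beta> \<in>
    hom (fibre X (Cod (Base X) u)) (FObj (prd P u) \<beta>) (FObj (reindex X t) \<beta>)"
proof -
  let ?K = "Dom (Base X) u" let ?L = "Cod (Base X) u"
  have u': "u \<in> hom (Base X) ?K ?L" using u display by (auto simp: hom_def)
  have t': "t \<in> hom (Base X) ?L ?K" using t by (simp add: is_section_def)
  have "prd_counit P u \<beta> \<in> hom (fibre X ?K) (FObj (reindex X u) (FObj (prd P u) \<beta>)) \<beta>"
    by (rule adjunction.counit_hom[OF products_adjunction[OF u] \<beta>])
  from fibre_Comp_hom[OF section_iso_hom[OF u' t prd_Obj[OF u \<beta>]] reindex_Arr_hom[OF t' this]]
  show ?thesis unfolding counit_at_def .
qed

text \<open>By associativity, postcomposition carries splittings to splittings with the same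
  section. It serves twice: with \<open>i\<close> invertible it transports splittings between
  isomorphic objects, and with \<open>h\<close> an identity it turns a splitting of that identity
  into one of \<open>i\<close>.\<close>

lemma splits_Comp:
  assumes u: "u \<in> \<F>" and \<beta>: "\<beta> \<in> Obj (fibre X (Dom (Base X) u))"
    and i: "i \<in> hom (fibre X (Cod (Base X) u)) \<gamma> \<gamma>'" and s: "splits X P u \<beta> \<gamma> h t k"
  shows "splits X P u \<beta> \<gamma>' (i \<cdot>\<^bsub>Total X\<^esub> h) t (i \<cdot>\<^bsub>Total X\<^esub> k)"
proof -
  have t: "is_section (Base X) u t"
    and k: "k \<in> hom (fibre X (Cod (Base X) u)) (FObj (reindex X t) \<beta>) \<gamma>"
    and h: "h = k \<cdot>\<^bsub>Total X\<^esub> counit_at X P u t \<beta>"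
    using s by (simp_all add: splits_def)
  show ?thesis
    using t h fibre_Comp_hom[OF k i] fibre_Comp_assoc[OF counit_at_hom[OF u \<beta> t] k i]
    by (simp add: splits_def)
qed

lemma quantifier_splitting_iff:
  "quantifier_splitting X \<F> P \<gamma> \<longleftrightarrow>
     (\<forall>u\<in>\<F>. Cod (Base X) u = FObj (Proj X) \<gamma> \<longrightarrow>
       (\<forall>\<beta> \<in> Obj (fibre X (Dom (Base X) u)).
        \<forall>h \<in> hom (fibre X (Cod (Base X) u)) (FObj (prd P u) \<beta>) \<gamma>.
          \<exists>!(t, k). splits X P u \<beta> \<gamma> h t k))"
  by (simp add: quantifier_splitting_def splits_def)

text \<open>With \<open>j\<close> inverse to \<open>i\<close>, splittings of \<open>h\<close>
  correspond to splittings of \<open>j \<cdot> h\<close> by postcomposition with \<open>j\<close>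
  and \<open>i\<close>; the section does not change.\<close>

lemma quantifier_splitting_iso:
  assumes i: "i \<in> hom (fibre X A) \<gamma> \<gamma>'" and iso: "is_iso (fibre X A) i"
    and \<gamma>: "quantifier_splitting X \<F> P \<gamma>"
  shows "quantifier_splitting X \<F> P \<gamma>'"
  unfolding quantifier_splitting_iff
proof (intro ballI impI)
  fix u \<beta> h
  assume u: "u \<in> \<F>" and Cod: "Cod (Base X) u = FObj (Proj X) \<gamma>'"
    and \<beta>: "\<beta> \<in> Obj (fibre X (Dom (Base X) u))"
    and h: "h \<in> hom (fibre X (Cod (Base X) u)) (FObj (prd P u) \<beta>) \<gamma>'"
  have A: "Cod (Base X) u = A" "FObj (Proj X) \<gamma> = A"
    using Cod hom_fibre_Cod[OF i] hom_fibre_Obj(1)[OF i] by auto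
  have iA: "i \<in> hom (fibre X (Cod (Base X) u)) \<gamma> \<gamma>'" using i A by simp
  obtain j where j: "j \<in> hom (fibre X (Cod (Base X) u)) \<gamma>' \<gamma>"
    and ji: "j \<cdot>\<^bsub>Total X\<^esub> i = Id (Total X) \<gamma>" and ij: "i \<cdot>\<^bsub>Total X\<^esub> j = Id (Total X) \<gamma>'"
    using iso i A by (auto simp: is_iso_def hom_def)
  have ij_h: "i \<cdot>\<^bsub>Total X\<^esub> (j \<cdot>\<^bsub>Total X\<^esub> k) = k"
    if "k \<in> hom (fibre X (Cod (Base X) u)) a \<gamma>'" for a k
    using fibre_Comp_assoc[OF that j iA] ij fibre_Id_Comp[OF that] by simp
  have "\<exists>!(t, k). splits X P u \<beta> \<gamma> (j \<cdot>\<^bsub>Total X\<^esub> h) t k"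
    using \<gamma> u \<beta> A fibre_Comp_hom[OF h j] by (simp add: quantifier_splitting_iff)
  then obtain t k where tk: "splits X P u \<beta> \<gamma> (j \<cdot>\<^bsub>Total X\<^esub> h) t k"
    and unique: "\<And>t' k'. splits X P u \<beta> \<gamma> (j \<cdot>\<^bsub>Total X\<^esub> h) t' k' \<Longrightarrow> t' = t \<and> k' = k"
    by (auto simp: Ex1_def)
  show "\<exists>!(t, k). splits X P u \<beta> \<gamma>' h t k"
  proof (rule ex1I[of _ "(t, i \<cdot>\<^bsub>Total X\<^esub> k)"])
    show "case (t, i \<cdot>\<^bsub>Total X\<^esub> k) of (t, k) \<Rightarrow> splits X P u \<beta> \<gamma>' h t k"
      using splits_Comp[OF u \<beta> iA tk] ij_h[OF h] by simp
  next
    fix p assume "case p of (t, k) \<Rightarrow> splits X P u \<beta> \<gamma>' h t k"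
    then obtain t' k' where p: "p = (t', k')" and s: "splits X P u \<beta> \<gamma>' h t' k'" by (cases p) auto
    \<comment> \<open>Postcomposition with \<open>j\<close> makes \<open>(t', j \<cdot> k')\<close>
      a splitting of \<open>j \<cdot> h\<close>, so \<open>j \<cdot> k' = k\<close>; this equation
      then recovers \<open>k'\<close> as \<open>i \<cdot> k\<close>.\<close>
    have "i \<cdot>\<^bsub>Total X\<^esub> (j \<cdot>\<^bsub>Total X\<^esub> k') = k'" using s ij_h by (auto simp: splits_def)
    then show "p = (t, i \<cdot>\<^bsub>Total X\<^esub> k)" using unique[OF splits_Comp[OF u \<beta> j s]] p by simp
  qed
qed

section \<open>From quantifier-freeness to the operators \<open>\<tau>\<close> and
  \<open>\<tau>'\<close>\<close>

text \<open>Forwards, reindex along an identity and return along the invertible cleavage arrow.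
  Backwards, every reindexed object is itself an object of \<open>Total X\<close>.\<close>

lemma all_quantifier_free_iff:
  "(\<forall>\<alpha>\<in>Obj (Total X). quantifier_free X \<F> P \<alpha>) \<longleftrightarrow>
   (\<forall>\<alpha>\<in>Obj (Total X). quantifier_splitting X \<F> P \<alpha>)"
proof (intro iffI ballI)
  fix \<alpha> assume free: "\<forall>\<alpha>\<in>Obj (Total X). quantifier_free X \<F> P \<alpha>" and \<alpha>: "\<alpha> \<in> Obj (Total X)"
  let ?A = "FObj (Proj X) \<alpha>"
  have \<alpha>': "\<alpha> \<in> Obj (fibre X ?A)" using \<alpha> by simp
  have "Id (Base X) ?A \<in> hom (Base X) ?A ?A" using B.Id_hom p.FObj_Obj[OF \<alpha>] .
  then have "quantifier_splitting X \<F> P (FObj (reindex X (Id (Base X) ?A)) \<alpha>)"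
    using free \<alpha> by (auto simp: quantifier_free_def hom_def)
  with is_iso_cleave_Id[OF \<alpha>'] show "quantifier_splitting X \<F> P \<alpha>"
    by (rule quantifier_splitting_iso)
next
  fix \<alpha> assume "\<forall>\<alpha>\<in>Obj (Total X). quantifier_splitting X \<F> P \<alpha>" "\<alpha> \<in> Obj (Total X)"
  then show "quantifier_free X \<F> P \<alpha>"
    using reindex_Obj[of _ _ "FObj (Proj X) \<alpha>" \<alpha>] by (auto simp: quantifier_free_def hom_def)
qed

text \<open>The operators at \<open>(\<alpha>, f)\<close> are the splitting of the identity of the
  product of \<open>\<alpha>\<close> along \<open>f\<close>. Extensionality fixes their values
  outside \<open>display_objects\<close>, so that their uniqueness concerns only meaningful
  arguments.\<close>

lemma all_quantifier_splitting_iff: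
  "(\<forall>\<alpha>\<in>Obj (Total X). quantifier_splitting X \<F> P \<alpha>) \<longleftrightarrow>
   (\<exists>!(\<tau>, \<tau>').
      \<tau> \<in> extensional (display_objects X \<F>) \<and> \<tau>' \<in> extensional (display_objects X \<F>) \<and>
      (\<forall>f\<in>\<F>. \<forall>\<alpha> \<in> Obj (fibre X (Dom (Base X) f)).
         splits X P f \<alpha> (FObj (prd P f) \<alpha>) (Id (Total X) (FObj (prd P f) \<alpha>)) (\<tau> (\<alpha>, f)) (\<tau>' (\<alpha>, f))) \<and>
      (\<forall>g\<in>\<F>. \<forall>\<beta> \<in> Obj (fibre X (Dom (Base X) g)). \<forall>\<gamma> \<in> Obj (fibre X (Cod (Base X) g)).
         \<forall>u \<in> hom (fibre X (Cod (Base X) g)) (FObj (prd P g) \<beta>) \<gamma>. \<forall>t h.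
           splits X P g \<beta> \<gamma> u t h \<longrightarrow> t = \<tau> (\<beta>, g) \<and> h = u \<cdot>\<^bsub>Total X\<^esub> \<tau>' (\<beta>, g)))"
    (is "?L \<longleftrightarrow> (\<exists>!(\<tau>, \<tau>'). ?R \<tau> \<tau>')")
proof
  assume L: ?L
  let ?id = "\<lambda>\<alpha> f. Id (Total X) (FObj (prd P f) \<alpha>)"
  let ?D = "display_objects X \<F>"
  let ?S = "\<lambda>f \<alpha> t k. splits X P f \<alpha> (FObj (prd P f) \<alpha>) (?id \<alpha> f) t k"
  have unique: "\<exists>!(t, k). splits X P u \<beta> \<gamma> h t k"
    if "u \<in> \<F>" "\<beta> \<in> Obj (fibre X (Dom (Base X) u))" "\<gamma> \<in> Obj (fibre X (Cod (Base X) u))"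
      "h \<in> hom (fibre X (Cod (Base X) u)) (FObj (prd P u) \<beta>) \<gamma>" for u \<beta> \<gamma> h
    using L that by (auto simp: quantifier_splitting_iff)
  have uniqueD: "t = t' \<and> k = k'"
    if "u \<in> \<F>" "\<beta> \<in> Obj (fibre X (Dom (Base X) u))" "\<gamma> \<in> Obj (fibre X (Cod (Base X) u))"
      "h \<in> hom (fibre X (Cod (Base X) u)) (FObj (prd P u) \<beta>) \<gamma>"
      "splits X P u \<beta> \<gamma> h t k" "splits X P u \<beta> \<gamma> h t' k'" for u \<beta> \<gamma> h t k t' k'
    using unique[OF that(1-4)] that(5,6) by (auto simp: Ex1_def)
  \<comment> \<open>Section and vertical arrow are chosen together as one pair \<open>q\<close>, so
    that the two components belong to the same splitting.\<close>
  have "\<forall>p\<in>?D. \<exists>q. ?S (snd p) (fst p) (fst q) (snd q)"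
  proof
    fix p assume "p \<in> ?D"
    then obtain \<alpha> f where p: "p = (\<alpha>, f)" and f: "f \<in> \<F>"
      and \<alpha>: "\<alpha> \<in> Obj (fibre X (Dom (Base X) f))"
      by (auto simp: display_objects_def)
    then show "\<exists>q. ?S (snd p) (fst p) (fst q) (snd q)"
      using unique[OF f \<alpha> prd_Obj[OF f \<alpha>] fibre_Id_hom[OF prd_Obj[OF f \<alpha>]]] by auto
  qed
  then obtain \<sigma> where \<sigma>: "\<And>p. p \<in> ?D \<Longrightarrow> ?S (snd p) (fst p) (fst (\<sigma> p)) (snd (\<sigma> p))"
    by metis
  define \<tau> \<tau>' where "\<tau> = restrict (\<lambda>p. fst (\<sigma> p)) ?D" and "\<tau>' = restrict (\<lambda>p. snd (\<sigma> p)) ?D"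
  have S: "?S f \<alpha> (\<tau> (\<alpha>, f)) (\<tau>' (\<alpha>, f))"
    if "f \<in> \<F>" "\<alpha> \<in> Obj (fibre X (Dom (Base X) f))" for f \<alpha>
  proof -
    have "(\<alpha>, f) \<in> ?D" using that by (simp add: display_objects_def)
    from \<sigma>[OF this] this show ?thesis by (simp add: \<tau>_def \<tau>'_def)
  qed
  show "\<exists>!(\<tau>, \<tau>'). ?R \<tau> \<tau>'"
  proof (rule ex1I[of _ "(\<tau>, \<tau>')"])
    \<comment> \<open>Condition 3: composing \<open>u\<close> with the chosen splitting of the
      identity also splits \<open>u\<close>, and \<open>u\<close> has only one splitting.\<close>
    have "t = \<tau> (\<beta>, g) \<and> h = u \<cdot>\<^bsub>Total X\<^esub> \<tau>' (\<beta>, g)"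
      if g: "g \<in> \<F>" and \<beta>: "\<beta> \<in> Obj (fibre X (Dom (Base X) g))"
        and \<gamma>: "\<gamma> \<in> Obj (fibre X (Cod (Base X) g))"
        and u: "u \<in> hom (fibre X (Cod (Base X) g)) (FObj (prd P g) \<beta>) \<gamma>"
        and s: "splits X P g \<beta> \<gamma> u t h" for g \<beta> \<gamma> u t h
      using uniqueD[OF g \<beta> \<gamma> u s] splits_Comp[OF g \<beta> u S[OF g \<beta>]] fibre_Comp_Id[OF u] by simp
    then show "case (\<tau>, \<tau>') of (\<tau>, \<tau>') \<Rightarrow> ?R \<tau> \<tau>'" using S by (simp add: \<tau>_def \<tau>'_def)
  next
    fix q assume "case q of (\<tau>, \<tau>') \<Rightarrow> ?R \<tau> \<tau>'"
    then obtain \<rho> \<rho>' where q: "q = (\<rho>, \<rho>')"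
      and ext: "\<rho> \<in> extensional ?D" "\<rho>' \<in> extensional ?D"
      and \<rho>: "\<And>f \<alpha>. f \<in> \<F> \<Longrightarrow> \<alpha> \<in> Obj (fibre X (Dom (Base X) f)) \<Longrightarrow>
        ?S f \<alpha> (\<rho> (\<alpha>, f)) (\<rho>' (\<alpha>, f))"
      by (cases q) auto
    \<comment> \<open>Any rival pair splits the same identities, so it agrees on \<open>?D\<close>
      because those splittings are unique.\<close>
    have eq: "\<rho> p = \<tau> p \<and> \<rho>' p = \<tau>' p" if pD: "p \<in> ?D" for p
    proof -
      obtain \<alpha> f where p: "p = (\<alpha>, f)" and f: "f \<in> \<F>"
        and \<alpha>: "\<alpha> \<in> Obj (fibre X (Dom (Base X) f))"
        using pD by (auto simp: display_objects_def)
      note \<pi> = prd_Obj[OF f \<alpha>]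
      have "?id \<alpha> f \<in> hom (fibre X (Cod (Base X) f)) (FObj (prd P f) \<alpha>) (FObj (prd P f) \<alpha>)"
        using fibre_Id_hom[OF \<pi>] .
      from uniqueD[OF f \<alpha> \<pi> this \<rho>[OF f \<alpha>] S[OF f \<alpha>]] show ?thesis by (simp add: p)
    qed
    have "\<rho> = \<tau>" by (rule extensionalityI[OF ext(1)]) (use eq in \<open>auto simp: \<tau>_def\<close>)
    moreover have "\<rho>' = \<tau>'" by (rule extensionalityI[OF ext(2)]) (use eq in \<open>auto simp: \<tau>'_def\<close>)
    ultimately show "q = (\<tau>, \<tau>')" by (simp add: q)
  qed
next
  assume "\<exists>!(\<tau>, \<tau>'). ?R \<tau> \<tau>'"
  then obtain \<tau> \<tau>' where R: "?R \<tau> \<tau>'" by auto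
  show ?L
    unfolding quantifier_splitting_iff
  proof (intro ballI impI)
    fix \<gamma> g \<beta> u
    assume "\<gamma> \<in> Obj (Total X)" "Cod (Base X) g = FObj (Proj X) \<gamma>" and g: "g \<in> \<F>"
      and \<beta>: "\<beta> \<in> Obj (fibre X (Dom (Base X) g))"
      and u: "u \<in> hom (fibre X (Cod (Base X) g)) (FObj (prd P g) \<beta>) \<gamma>"
    then have \<gamma>: "\<gamma> \<in> Obj (fibre X (Cod (Base X) g))" by simp
    show "\<exists>!(t, k). splits X P g \<beta> \<gamma> u t k"
    \<comment> \<open>Existence comes from composing \<open>u\<close> with the splitting of the
      identity in condition 2; uniqueness is condition 3.\<close>
    proof (rule ex1I[of _ "(\<tau> (\<beta>, g), u \<cdot>\<^bsub>Total X\<^esub> \<tau>' (\<beta>, g))"])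
      have "splits X P g \<beta> (FObj (prd P g) \<beta>) (Id (Total X) (FObj (prd P g) \<beta>)) (\<tau> (\<beta>, g)) (\<tau>' (\<beta>, g))"
        using R g \<beta> by blast
      from splits_Comp[OF g \<beta> u this]
      show "case (\<tau> (\<beta>, g), u \<cdot>\<^bsub>Total X\<^esub> \<tau>' (\<beta>, g)) of (t, k) \<Rightarrow> splits X P g \<beta> \<gamma> u t k"
        using fibre_Comp_Id[OF u] by simp
    next
      fix q assume "case q of (t, k) \<Rightarrow> splits X P g \<beta> \<gamma> u t k"
      then show "q = (\<tau> (\<beta>, g), u \<cdot>\<^bsub>Total X\<^esub> \<tau>' (\<beta>, g))"
        using R g \<beta> \<gamma> u by (cases q) auto
    qed
  qed
qed

end

end

theorem theorem4p14:
  fixes X :: "('bo, 'ba, 'eo, 'ea) fibration"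
    and \<F> :: "'ba set"
    and P :: "('ba, 'eo, 'ea) products"
  assumes "display_map_category (Base X) \<F>"
    and "has_dependent_coproducts (Base X) \<F>"
    and "cloven_fibration X"
    and "fibred_products X \<F> P"
  shows "dependent_hilbert_tau_fibration X \<F> P \<longleftrightarrow>
    (\<exists>!(\<tau>, \<tau>').
       \<tau> \<in> extensional (display_objects X \<F>) \<and> \<tau>' \<in> extensional (display_objects X \<F>) \<and>
       (\<forall>I J. \<forall>f \<in> \<F> \<inter> hom (Base X) I J. \<forall>\<alpha> \<in> Obj (fibre X I).
          \<tau> (\<alpha>, f) \<in> hom (Base X) J I \<and>
          \<tau>' (\<alpha>, f) \<in> hom (fibre X J) (FObj (reindex X (\<tau> (\<alpha>, f))) \<alpha>) (FObj (prd P f) \<alpha>) \<and>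
          f \<cdot>\<^bsub>Base X\<^esub> \<tau> (\<alpha>, f) = Id (Base X) J \<and>
          Id (Total X) (FObj (prd P f) \<alpha>) =
            \<tau>' (\<alpha>, f) \<cdot>\<^bsub>Total X\<^esub> counit_at X P f (\<tau> (\<alpha>, f)) \<alpha>) \<and>
       (\<forall>K L. \<forall>g \<in> \<F> \<inter> hom (Base X) K L. \<forall>\<beta> \<in> Obj (fibre X K). \<forall>\<gamma> \<in> Obj (fibre X L).
          \<forall>u \<in> hom (fibre X L) (FObj (prd P g) \<beta>) \<gamma>. \<forall>t h.
            is_section (Base X) g t \<and>
            h \<in> hom (fibre X L) (FObj (reindex X t) \<beta>) \<gamma> \<and>
            u = h \<cdot>\<^bsub>Total X\<^esub> counit_at X P g t \<beta> \<longrightarrow>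
            t = \<tau> (\<beta>, g) \<and> h = u \<cdot>\<^bsub>Total X\<^esub> \<tau>' (\<beta>, g)))"
proof -
  have \<F>: "\<F> \<subseteq> Arr (Base X)" using assms(1) by (simp add: display_map_category_def)
  \<comment> \<open>The endpoints \<open>I\<close> and \<open>J\<close> are determined by
    \<open>f\<close>, so quantifying over them can be replaced by \<open>Dom\<close> and
    \<open>Cod\<close>.\<close>
  have F1: "(\<forall>I J. \<forall>f \<in> \<F> \<inter> hom (Base X) I J. Q I J f) \<longleftrightarrow>
      (\<forall>f\<in>\<F>. Q (Dom (Base X) f) (Cod (Base X) f) f)" for Q
    using \<F> by (auto simp: hom_def)
  \<comment> \<open>In conditions 1 and 2 the two halves of \<open>is_section\<close> are separated
    by the typing of \<open>k\<close>, so this form needs its own rewrite rule; the premise of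
    condition 3 matches \<open>splits_def\<close> directly.\<close>
  have S1: "t \<in> hom (Base X) (Cod (Base X) f) (Dom (Base X) f) \<and>
      k \<in> hom (fibre X (Cod (Base X) f)) (FObj (reindex X t) \<alpha>) \<gamma> \<and>
      f \<cdot>\<^bsub>Base X\<^esub> t = Id (Base X) (Cod (Base X) f) \<and>
      h = k \<cdot>\<^bsub>Total X\<^esub> counit_at X P f t \<alpha> \<longleftrightarrow> splits X P f \<alpha> \<gamma> h t k" for f \<alpha> \<gamma> h t k
    by (auto simp: splits_def is_section_def)
  show ?thesis
    unfolding F1 S1 splits_def[symmetric]
    using all_quantifier_free_iff[OF assms(3) \<F> assms(4)]
      all_quantifier_splitting_iff[OF assms(3) \<F> assms(4)] assms
    by (simp only: dependent_hilbert_tau_fibration_def simp_thms)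
qed

end
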